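(* Let $G=(V,E)$ be a finite strongly connected simple directed graph with the property that $\mathbb{P}(L(u,v)) = \mathbb{P}(L(u,w))$ for any three distinct vertices $u,v,w\in V$. Then every edge of $G$ is bidirected, that is, for all $u,v\in V$, if $uv\in E$ then $vu\in E$.
   Context: A simple directed graph (digraph) has no loops and at most one edge from $u$ to $v$ for each ordered pair of distinct vertices $(u,v)$; both $uv$ and $vu$ may be edges, where $uv$ denotes the edge directed from $u$ to $v$. The random walk on $G$ moves at each step from its current vertex to an out-neighbor of that vertex chosen uniformly at random, independently of the past. A random cover tour from $u$ is this random walk started at $u$ (the starting vertex $u$ counts as visited) and stopped at the first time it has visited every vertex of $G$; in a finite strongly connected digraph it terminates almost surely. $L(u,v)$ denotes the event that the random cover tour from $u$ ends at $v$, i.e. that $v$ is the last vertex to be visited for the first time. *)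

theory Defs
  imports "HOL-Probability.Probability" "Graph_Theory.Digraph_Component"
begin

text \<open>
  If \<open>v\<close> has no out-neighbour, \<open>pmf_of_set {}\<close> is an unspecified probability mass function. In a
  strongly connected digraph this only happens when \<open>v\<close> is the sole vertex.
\<close>

definition walk_step :: "('a, 'b) pre_digraph \<Rightarrow> 'a \<Rightarrow> 'a pmf" where
  "walk_step G v = pmf_of_set {w. v \<rightarrow>\<^bsub>G\<^esub> w}"

text \<open>
  The law of the vertex visited at time \<open>n\<close>, given the vertices \<open>\<omega> 0, \<dots>, \<omega> (n - 1)\<close> visited before.
\<close>

primrec walk_kernel :: "('a, 'b) pre_digraph \<Rightarrow> 'a \<Rightarrow> nat \<Rightarrow> (nat \<Rightarrow> 'a) \<Rightarrow> 'a measure" where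
  "walk_kernel G u 0 \<omega> = measure_pmf (return_pmf u)"
| "walk_kernel G u (Suc n) \<omega> = measure_pmf (walk_step G (\<omega> n))"

lemma Ionescu_Tulcea_walk: "Ionescu_Tulcea (walk_kernel G u) (\<lambda>_. count_space UNIV)"
proof (rule Ionescu_Tulcea.intro)
  have pmf: "measure_pmf p \<in> space (subprob_algebra (count_space UNIV))" for p :: "'a pmf"
    by (simp add: space_subprob_algebra prob_space_imp_subprob_space prob_space_measure_pmf)
  show "walk_kernel G u i \<in> PiM {0..<i} (\<lambda>_. count_space UNIV) \<rightarrow>\<^sub>M subprob_algebra (count_space UNIV)"
    for i
  proof (cases i)
    case 0
    have "walk_kernel G u 0 = (\<lambda>_. measure_pmf (return_pmf u))"
      by (simp add: fun_eq_iff)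
    then show ?thesis
      using pmf by (simp add: 0)
  next
    case (Suc n)
    have "walk_kernel G u (Suc n) = (\<lambda>\<omega>. measure_pmf (walk_step G (\<omega> n)))"
      by (simp add: fun_eq_iff)
    moreover have "(\<lambda>\<omega>. measure_pmf (walk_step G (\<omega> n)))
      \<in> PiM {0..<Suc n} (\<lambda>_. count_space UNIV) \<rightarrow>\<^sub>M subprob_algebra (count_space UNIV)"
    proof (rule measurable_compose[where g="\<lambda>v. measure_pmf (walk_step G v)"])
      show "(\<lambda>\<omega>. \<omega> n) \<in> PiM {0..<Suc n} (\<lambda>_. count_space UNIV) \<rightarrow>\<^sub>M count_space UNIV"
        by (rule measurable_component_singleton) simp
    qed (simp add: pmf)
    ultimately show ?thesis
      by (simp add: Suc)
  qed
  show "prob_space (walk_kernel G u i x)" for i x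
    by (cases i) (auto intro: prob_space_measure_pmf)
qed

text \<open>
  The law of the trajectory of the walk started at \<open>u\<close>, as given by the Ionescu-Tulcea theorem.
\<close>

definition random_walk :: "('a, 'b) pre_digraph \<Rightarrow> 'a \<Rightarrow> (nat \<Rightarrow> 'a) measure" where
  "random_walk G u = projective_family.lim UNIV
     (Ionescu_Tulcea.CI (walk_kernel G u) (\<lambda>_. count_space UNIV)) (\<lambda>_. count_space UNIV)"

lemma sets_random_walk [measurable_cong]:
  "sets (random_walk G u) = sets (PiM UNIV (\<lambda>_. count_space UNIV))"
proof -
  interpret Ionescu_Tulcea "walk_kernel G u" "\<lambda>_. count_space UNIV"
    by (rule Ionescu_Tulcea_walk)
  show ?thesis
    by (simp add: random_walk_def)
qed

lemma space_random_walk [simp]: "space (random_walk G u) = UNIV"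
  using sets_eq_imp_space_eq[OF sets_random_walk, of G u] by (simp add: space_PiM)

lemma emeasure_random_walk_cylinder:
  "emeasure (random_walk G u) {\<omega>. \<forall>i\<le>n. \<omega> i = x i} =
     (if x 0 = u then \<Prod>i<n. ennreal (pmf (walk_step G (x i)) (x (Suc i))) else 0)"
proof -
  interpret Ionescu_Tulcea "walk_kernel G u" "\<lambda>_. count_space UNIV"
    by (rule Ionescu_Tulcea_walk)
  let ?M = "\<lambda>_::nat. count_space (UNIV :: 'a set)"
  define A where "A n = PiE {0..<n} (\<lambda>i. {x i})" for n
  have A_sets[measurable]: "A n \<in> sets (PiM {0..<n} ?M)" for n
    unfolding A_def by (rule sets_PiM_I_finite) auto
  have eP: "emeasure (eP n \<omega>) (A (Suc n)) = emeasure (walk_kernel G u n \<omega>) {x n} * indicator (A n) \<omega>"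
    if "\<omega> \<in> space (PiM {0..<n} ?M)" for n \<omega>
  proof -
    have "(\<lambda>y. fun_upd \<omega> n y) -` A (Suc n) = (if \<omega> \<in> A n then {x n} else {})"
      using that by (auto simp: A_def space_PiM PiE_iff extensional_def atLeastLessThanSuc)
    then show ?thesis
      using that by (subst emeasure_eP) (auto simp: A_sets)
  qed
  have Suc_C: "emeasure (C 0 (Suc n) (\<lambda>_. undefined)) (A (Suc n)) =
      (\<integral>\<^sup>+\<omega>. emeasure (walk_kernel G u n \<omega>) {x n} * indicator (A n) \<omega> \<partial>C 0 n (\<lambda>_. undefined))" for n
  proof -
    have "emeasure (C 0 (Suc n) (\<lambda>_. undefined)) (A (Suc n)) =
      (\<integral>\<^sup>+\<omega>. emeasure (eP n \<omega>) (A (Suc n)) \<partial>C 0 n (\<lambda>_. undefined))"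
      using measurable_eP[of n] sets_C[of "\<lambda>_. undefined" 0 n]
      by (subst C.simps, subst emeasure_bind[where N="PiM {0..<Suc n} ?M"])
        (auto simp: space_C space_PiM_empty_iff cong: measurable_cong_sets)
    also have "\<dots> = (\<integral>\<^sup>+\<omega>. emeasure (walk_kernel G u n \<omega>) {x n} * indicator (A n) \<omega> \<partial>C 0 n (\<lambda>_. undefined))"
      by (intro nn_integral_cong eP) (simp add: space_C)
    finally show ?thesis .
  qed
  have *: "emeasure (C 0 (Suc n) (\<lambda>_. undefined)) (A (Suc n)) =
     (if x 0 = u then \<Prod>i<n. ennreal (pmf (walk_step G (x i)) (x (Suc i))) else 0)" for n
  proof (induction n)
    case 0
    have "A 0 = {\<lambda>_. undefined}"
      by (auto simp: A_def)
    then show ?case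
      using A_sets[of 0] unfolding Suc_C[of 0]
      by (simp add: nn_integral_cmult emeasure_pmf_single)
  next
    case (Suc n)
    have "emeasure (C 0 (Suc (Suc n)) (\<lambda>_. undefined)) (A (Suc (Suc n))) =
        (\<integral>\<^sup>+\<omega>. ennreal (pmf (walk_step G (x n)) (x (Suc n))) * indicator (A (Suc n)) \<omega>
          \<partial>C 0 (Suc n) (\<lambda>_. undefined))"
      unfolding Suc_C[of "Suc n"]
      by (intro nn_integral_cong) (auto simp: emeasure_pmf_single A_def PiE_iff split: split_indicator)
    also have "\<dots> = ennreal (pmf (walk_step G (x n)) (x (Suc n))) * emeasure (C 0 (Suc n) (\<lambda>_. undefined)) (A (Suc n))"
      using A_sets[of "Suc n"] sets_C[of "\<lambda>_. undefined" 0 "Suc n"]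
      by (intro nn_integral_cmult_indicator) simp
    finally show ?case
      by (simp add: Suc.IH mult.commute del: C.simps)
  qed
  have "{\<omega>. \<forall>i\<le>n. \<omega> i = x i} = PF.emb UNIV {0..<Suc n} (A (Suc n))"
    by (auto simp: prod_emb_def A_def PiE_iff less_Suc_eq_le)
  then have "emeasure (random_walk G u) {\<omega>. \<forall>i\<le>n. \<omega> i = x i} = emeasure (CI {0..<Suc n}) (A (Suc n))"
    unfolding random_walk_def using lim[of "{0..<Suc n}" "A (Suc n)"] by simp
  also have "\<dots> = emeasure (C 0 (Suc n) (\<lambda>_. undefined)) (A (Suc n))"
    using emeasure_CI[of "{0..<Suc n}" "Suc n" "A (Suc n)"] A_sets[of "Suc n"]
    by (simp add: prod_emb_id A_def PiE_mono del: C.simps)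
  finally show ?thesis
    by (simp add: * del: C.simps)
qed

lemma prob_space_random_walk: "prob_space (random_walk G u)"
proof -
  interpret Ionescu_Tulcea "walk_kernel G u" "\<lambda>_. count_space UNIV"
    by (rule Ionescu_Tulcea_walk)
  interpret CI: prob_space "CI {}"
    by (rule PF.prob_space_P) simp_all
  have "emeasure (random_walk G u) UNIV = emeasure (CI {}) {\<lambda>_. undefined}"
    unfolding random_walk_def using lim[of "{}" "{\<lambda>_. undefined}", OF finite.emptyI]
    by (simp add: prod_emb_def sets_PiM_empty space_PiM restrict_def vimage_def)
  also have "\<dots> = 1"
    using CI.emeasure_space_1 by (simp add: CI_def space_PiM)
  finally show ?thesis
    by (intro prob_spaceI) simp
qed

definition covered_by :: "('a, 'b) pre_digraph \<Rightarrow> (nat \<Rightarrow> 'a) \<Rightarrow> nat \<Rightarrow> bool" where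
  "covered_by G \<omega> n \<longleftrightarrow> verts G \<subseteq> \<omega> ` {..n}"

text \<open>The value is arbitrary for trajectories that never cover \<open>G\<close>.\<close>

definition cover_time :: "('a, 'b) pre_digraph \<Rightarrow> (nat \<Rightarrow> 'a) \<Rightarrow> nat" where
  "cover_time G \<omega> = (LEAST n. covered_by G \<omega> n)"

text \<open>The trajectories for which the cover tour terminates, and does so at \<open>v\<close>.\<close>

definition cover_tour_ends_at :: "('a, 'b) pre_digraph \<Rightarrow> 'a \<Rightarrow> (nat \<Rightarrow> 'a) set" where
  "cover_tour_ends_at G v = {\<omega>. (\<exists>n. covered_by G \<omega> n) \<and> \<omega> (cover_time G \<omega>) = v}"

lemma sets_cover_tour_ends_at:
  assumes "finite (verts G)"
  shows "cover_tour_ends_at G v \<in> sets (random_walk G u)"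
proof -
  have *: "cover_tour_ends_at G v =
     (\<Union>n. {\<omega>. covered_by G \<omega> n} \<inter> (\<Inter>m\<in>{..<n}. - {\<omega>. covered_by G \<omega> m}) \<inter> {\<omega>. \<omega> n = v})"
    unfolding cover_tour_ends_at_def cover_time_def
    by (auto intro: LeastI dest: not_less_Least intro!: exI[of _ "LEAST n. covered_by G _ n"])
      (metis LeastI lessThan_iff linorder_neqE_nat not_less_Least)
  have "{\<omega>. \<omega> i = w} \<in> sets (random_walk G u)" for i w
    using measurable_sets[OF measurable_component_singleton[of i UNIV "\<lambda>_. count_space UNIV"], of "{w}"]
    by (simp add: sets_random_walk space_PiM vimage_def)
  note S = this
  have C: "{\<omega>. covered_by G \<omega> n} \<in> sets (random_walk G u)" for n
  proof -
    have "Measurable.pred (random_walk G u) (\<lambda>\<omega>. \<forall>w\<in>verts G. \<exists>i\<in>{..n}. \<omega> i = w)"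
      using assms S[unfolded pred_def] by (intro pred_intros_finite) (auto simp: pred_def S)
    moreover have "covered_by G \<omega> n \<longleftrightarrow> (\<forall>w\<in>verts G. \<exists>i\<in>{..n}. \<omega> i = w)" for \<omega>
      by (auto simp: covered_by_def)
    ultimately show ?thesis
      by (simp add: pred_def)
  qed
  have "- {\<omega>. covered_by G \<omega> m} \<in> sets (random_walk G u)" for m
    using sets.compl_sets[OF C[of m]] by (simp add: Compl_eq_Diff_UNIV)
  then show ?thesis
    unfolding * using C S
    by (intro sets.countable_UN sets.Int) (auto intro!: sets.countable_INT)
qed

end

theory Submission
  imports Defs
begin

text \<open>
  The covering probability is superharmonic, hence constant, so the hypothesis makes
  \<open>P(L(u,v)) = p > 0\<close> for all \<open>u \<noteq> v\<close>. Condition on the first step \<open>u \<rightarrow> x\<close>: the walk from \<open>x\<close> makes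
  the whole walk end at \<open>v\<close> if its own tour ends at \<open>v\<close>, or if it covers \<open>V - {u, v}\<close> and then
  meets \<open>v\<close>, all before meeting \<open>u\<close>; let \<open>q(x)\<close> be the probability of the second case. Averaging over
  \<open>x\<close>, all \<open>q(x)\<close> vanish if \<open>uv\<close> is not an edge, and \<open>q(x) > 0\<close> for some \<open>x \<noteq> v\<close> if it is.

  Suppose that \<open>uv\<close> is an edge and \<open>vu\<close> is not, and put \<open>H = V - {u, v}\<close>. The edge \<open>uv\<close> gives a walk
  inside \<open>H\<close> that covers \<open>H\<close>, from some \<open>x\<close> to some \<open>z\<close>, and \<open>P(L(z,v)) > 0\<close> prolongs it inside \<open>H\<close>
  to an in-neighbour of \<open>u\<close>. Let \<open>C\<close> be the set of vertices that reach \<open>x\<close> inside \<open>H\<close>. Since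
  \<open>P(L(v,u)) > 0\<close>, some walk goes from \<open>v\<close> to \<open>x\<close> avoiding \<open>u\<close>, and it can enter \<open>C\<close> only from \<open>v\<close>. So \<open>v\<close>
  has an out-neighbour in \<open>C\<close>, from which one can cover \<open>H\<close> inside \<open>H\<close> and then step to \<open>u\<close>; this is
  excluded because \<open>vu\<close> is not an edge.
\<close>

section \<open>Measures on trajectories\<close>

abbreviation cylinder :: "nat \<Rightarrow> (nat \<Rightarrow> 'a) \<Rightarrow> (nat \<Rightarrow> 'a) set" where
  "cylinder n x \<equiv> {\<omega>. \<forall>i\<le>n. \<omega> i = x i}"

lemma sets_component_event:
  fixes M :: "(nat \<Rightarrow> 'a) measure"
  assumes "sets M = sets (PiM UNIV (\<lambda>_. count_space UNIV))"
  shows "{\<omega>. \<omega> i \<in> A} \<in> sets M"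
  using measurable_sets[OF measurable_component_singleton[of i UNIV "\<lambda>_. count_space UNIV"], of A]
  by (simp add: assms space_PiM vimage_def)

lemma sets_pointwise_event:
  fixes M :: "(nat \<Rightarrow> 'a) measure"
  assumes "sets M = sets (PiM UNIV (\<lambda>_. count_space UNIV))"
  shows "{\<omega>. \<forall>i. \<omega> i \<in> A i} \<in> sets M"
proof -
  have "{\<omega>. \<forall>i. \<omega> i \<in> A i} = (\<Inter>i. {\<omega>. \<omega> i \<in> A i})"
    by auto
  also have "\<dots> \<in> sets M"
    by (intro sets.countable_INT sets_component_event image_subsetI assms) simp
  finally show ?thesis .
qed

lemma sets_cylinder:
  fixes M :: "(nat \<Rightarrow> 'a) measure"
  assumes "sets M = sets (PiM UNIV (\<lambda>_. count_space UNIV))"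
  shows "cylinder n x \<in> sets M"
proof -
  have "cylinder n x = (\<Inter>i\<in>{..n}. {\<omega>. \<omega> i \<in> {x i}})"
    by auto
  also have "\<dots> \<in> sets M"
    by (intro sets.finite_INT sets_component_event assms) auto
  finally show ?thesis .
qed

text \<open>Almost surely a trajectory stays in the finite set \<open>D\<close>, so up to a null set
  a rectangle is a finite disjoint union of cylinders.\<close>

lemma emeasure_rectangle_eq_sum_cylinders:
  fixes M :: "(nat \<Rightarrow> 'a) measure"
  assumes M: "sets M = sets (PiM UNIV (\<lambda>_. count_space UNIV))"
    and D: "finite D" "AE \<omega> in M. \<forall>i. \<omega> i \<in> D"
    and n: "\<forall>i\<in>J. i \<le> n"
  shows "emeasure M {\<omega>. \<forall>i\<in>J. \<omega> i \<in> A i} =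
    (\<Sum>x \<in> {x \<in> PiE {..n} (\<lambda>_. D). \<forall>i\<in>J. x i \<in> A i}. emeasure M (cylinder n x))"
proof -
  \<comment> \<open>Prefixes are taken extensional: this leaves finitely many, and distinct ones
    differ at some \<open>i \<le> n\<close>.\<close>
  let ?X = "{x \<in> PiE {..n} (\<lambda>_. D). \<forall>i\<in>J. x i \<in> A i}"
  have fin: "finite ?X"
    using D(1) by (auto intro!: finite_PiE)
  have "{\<omega>. \<forall>i\<in>J. \<omega> i \<in> A i} = {\<omega>. \<forall>i. \<omega> i \<in> (if i \<in> J then A i else UNIV)}"
    by auto
  also have "\<dots> \<in> sets M"
    by (rule sets_pointwise_event[OF M])
  finally have "emeasure M {\<omega>. \<forall>i\<in>J. \<omega> i \<in> A i} = emeasure M (\<Union>x\<in>?X. cylinder n x)"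
  proof (intro emeasure_eq_AE)
    show "(\<Union>x\<in>?X. cylinder n x) \<in> sets M"
      using fin by (intro sets.finite_UN sets_cylinder M) auto
    show "AE \<omega> in M. \<omega> \<in> {\<omega>. \<forall>i\<in>J. \<omega> i \<in> A i} \<longleftrightarrow> \<omega> \<in> (\<Union>x\<in>?X. cylinder n x)"
      using D(2)
    proof eventually_elim
      case (elim \<omega>)
      show ?case
      proof
        assume "\<omega> \<in> {\<omega>. \<forall>i\<in>J. \<omega> i \<in> A i}"
        then show "\<omega> \<in> (\<Union>x\<in>?X. cylinder n x)"
          using elim n by (intro UN_I[of "restrict \<omega> {..n}"]) auto
      next
        assume "\<omega> \<in> (\<Union>x\<in>?X. cylinder n x)"
        then obtain x where "\<forall>i\<le>n. \<omega> i = x i" "\<forall>i\<in>J. x i \<in> A i"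
          by blast
        then show "\<omega> \<in> {\<omega>. \<forall>i\<in>J. \<omega> i \<in> A i}"
          using n by simp
      qed
    qed
  qed
  also have "\<dots> = (\<Sum>x\<in>?X. emeasure M (cylinder n x))"
  proof (intro sum_emeasure[symmetric] fin)
    show "disjoint_family_on (cylinder n) ?X"
    proof (unfold disjoint_family_on_def, intro ballI impI)
      fix x y assume xy: "x \<in> ?X" "y \<in> ?X" "x \<noteq> y"
      have "\<exists>i\<le>n. x i \<noteq> y i"
      proof (rule ccontr)
        assume "\<not> (\<exists>i\<le>n. x i \<noteq> y i)"
        with xy have "x = y"
          by (intro PiE_ext[of x "{..n}" "\<lambda>_. D" y]) auto
        with xy show False by simp
      qed
      then show "cylinder n x \<inter> cylinder n y = {}"
        by auto
    qed
    show "cylinder n ` ?X \<subseteq> sets M"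
      using sets_cylinder[OF M] by auto
  qed
  finally show ?thesis .
qed

text \<open>Finite rectangles determine a finite measure and decompose into cylinders, the events on
  which \<open>emeasure_random_walk_cylinder\<close> computes the law of the walk.\<close>

lemma measure_eqI_cylinders:
  fixes M N :: "(nat \<Rightarrow> 'a) measure"
  assumes M: "sets M = sets (PiM UNIV (\<lambda>_. count_space UNIV))"
    and N: "sets N = sets (PiM UNIV (\<lambda>_. count_space UNIV))"
    and D: "finite D" "AE \<omega> in M. \<forall>i. \<omega> i \<in> D" "AE \<omega> in N. \<forall>i. \<omega> i \<in> D"
    and eq: "\<And>n x. emeasure M (cylinder n x) = emeasure N (cylinder n x)"
    and "finite_measure M"
  shows "M = N"
proof (rule measure_eqI_PiM_infinite[OF M N])
  fix A :: "nat \<Rightarrow> 'a set" and J :: "nat set"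
  assume J: "finite J"
  have *: "prod_emb UNIV (\<lambda>_. count_space UNIV) J (PiE J A) = {\<omega>. \<forall>i\<in>J. \<omega> i \<in> A i}"
    by (auto simp: prod_emb_def PiE_iff)
  obtain n where "\<forall>i\<in>J. i \<le> n"
    using J by (auto simp: finite_nat_set_iff_bounded_le)
  then show "emeasure M (prod_emb UNIV (\<lambda>_. count_space UNIV) J (PiE J A)) =
      emeasure N (prod_emb UNIV (\<lambda>_. count_space UNIV) J (PiE J A))"
    unfolding * using emeasure_rectangle_eq_sum_cylinders[OF M D(1,2)]
      emeasure_rectangle_eq_sum_cylinders[OF N D(1,3)] by (simp add: eq)
qed fact

text \<open>\<open>case_nat u\<close> puts \<open>u\<close> in front of a trajectory; preimages
  under it express conditioning on the first step.\<close>

lemma measurable_case_nat_path: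
  "case_nat u \<in> PiM UNIV (\<lambda>_. count_space UNIV) \<rightarrow>\<^sub>M PiM UNIV (\<lambda>_. count_space UNIV)"
proof (rule measurable_PiM_single')
  show "(\<lambda>\<omega>. case_nat u \<omega> i) \<in> PiM UNIV (\<lambda>_. count_space UNIV) \<rightarrow>\<^sub>M count_space UNIV" for i
    by (cases i) (auto intro: measurable_component_singleton)
qed auto

section \<open>Cover tours\<close>

lemma image_case_nat_atMost: "case_nat u \<omega> ` {..Suc n} = insert u (\<omega> ` {..n})"
  by (simp add: atMost_Suc_eq_insert_0 image_image)

text \<open>The last new vertex completes the cover when it is first met, so \<open>T\<close> is
  both the first visit to \<open>v\<close> and the cover time. This form replaces
  \<open>LEAST\<close> by a witness.\<close>

lemma mem_cover_tour_ends_at_iff: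
  assumes "v \<in> verts G"
  shows "\<omega> \<in> cover_tour_ends_at G v \<longleftrightarrow>
    (\<exists>T. \<omega> T = v \<and> (\<forall>i<T. \<omega> i \<noteq> v) \<and> verts G \<subseteq> \<omega> ` {..T})"
proof
  assume "\<omega> \<in> cover_tour_ends_at G v"
  then obtain n where n: "covered_by G \<omega> n" and v: "\<omega> (cover_time G \<omega>) = v"
    by (auto simp: cover_tour_ends_at_def)
  define T where "T = cover_time G \<omega>"
  have T: "covered_by G \<omega> T"
    unfolding T_def cover_time_def using n by (rule LeastI)
  \<comment> \<open>A visit to \<open>v\<close> before \<open>T\<close> would make position
    \<open>T\<close> redundant, so \<open>T - 1\<close> would already cover.\<close>
  have "\<omega> i \<noteq> v" if "i < T" for i
  proof
    assume "\<omega> i = v"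
    then have "\<omega> ` {..T} = \<omega> ` {..T - 1}"
      using that v atMost_Suc[of "T - 1"] by (auto simp: T_def[symmetric])
    then have "covered_by G \<omega> (T - 1)"
      using T by (simp add: covered_by_def)
    then show False
      using that not_less_Least[of "T - 1" "covered_by G \<omega>"] by (simp add: T_def cover_time_def)
  qed
  then show "\<exists>T. \<omega> T = v \<and> (\<forall>i<T. \<omega> i \<noteq> v) \<and> verts G \<subseteq> \<omega> ` {..T}"
    using v T by (auto simp: T_def covered_by_def)
next
  assume "\<exists>T. \<omega> T = v \<and> (\<forall>i<T. \<omega> i \<noteq> v) \<and> verts G \<subseteq> \<omega> ` {..T}"
  then obtain T where T: "\<omega> T = v" "\<forall>i<T. \<omega> i \<noteq> v" "covered_by G \<omega> T"
    by (auto simp: covered_by_def)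
  have "cover_time G \<omega> = T"
    unfolding cover_time_def
  proof (rule Least_equality)
    show "covered_by G \<omega> T" by fact
  next
    fix n assume "covered_by G \<omega> n"
    then obtain i where "i \<le> n" "\<omega> i = v"
      using assms by (auto simp: covered_by_def)
    then have "\<not> i < T"
      using T(2) by blast
    with \<open>i \<le> n\<close> show "T \<le> n"
      by simp
  qed
  then show "\<omega> \<in> cover_tour_ends_at G v"
    using T by (auto simp: cover_tour_ends_at_def)
qed

text \<open>A position outside \<open>verts G\<close> never completes a cover, so by minimality the
  tour ends in \<open>verts G\<close>. The empty digraph is covered at time 0 whatever stands there,
  hence the assumption.\<close>

lemma cover_tour_ends_at_UN:
  assumes "verts G \<noteq> {}"
  shows "(\<Union>v\<in>verts G. cover_tour_ends_at G v) = {\<omega>. \<exists>n. covered_by G \<omega> n}"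
proof -
  have "\<omega> (cover_time G \<omega>) \<in> verts G" if "covered_by G \<omega> n" for \<omega> n
  proof (rule ccontr)
    define T where "T = cover_time G \<omega>"
    assume *: "\<omega> (cover_time G \<omega>) \<notin> verts G"
    have T: "covered_by G \<omega> T"
      unfolding T_def cover_time_def using that by (rule LeastI)
    with * assms have "T \<noteq> 0"
      by (auto simp: covered_by_def T_def)
    with T * have "covered_by G \<omega> (T - 1)"
      using atMost_Suc[of "T - 1"] by (auto simp: covered_by_def T_def[symmetric])
    then show False
      using \<open>T \<noteq> 0\<close> not_less_Least[of "T - 1" "covered_by G \<omega>"] by (simp add: T_def cover_time_def)
  qed
  then show ?thesis
    by (auto simp: cover_tour_ends_at_def)
qed

section \<open>The Markov property of the random walk\<close>

text \<open>Out-neighbours make \<open>walk_step\<close> the uniform law on a nonempty set instead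
  of an unspecified one.\<close>

locale walkable_digraph = fin_digraph +
  assumes out_neighbour_exists: "v \<in> verts G \<Longrightarrow> \<exists>w. v \<rightarrow>\<^bsub>G\<^esub> w"
begin

abbreviation out_neighbours :: "'a \<Rightarrow> 'a set" where
  "out_neighbours v \<equiv> {w. v \<rightarrow>\<^bsub>G\<^esub> w}"

abbreviation walk_prob :: "'a \<Rightarrow> (nat \<Rightarrow> 'a) set \<Rightarrow> real" where
  "walk_prob u \<equiv> measure (random_walk G u)"

lemma out_neighbours_subset: "out_neighbours v \<subseteq> verts G"
  using adj_in_verts by auto

lemma finite_out_neighbours [simp]: "finite (out_neighbours v)"
  using out_neighbours_subset finite_verts by (rule finite_subset)

lemma out_neighbours_nonempty: "v \<in> verts G \<Longrightarrow> out_neighbours v \<noteq> {}"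
  using out_neighbour_exists by auto

lemma set_pmf_walk_step: "v \<in> verts G \<Longrightarrow> set_pmf (walk_step G v) = out_neighbours v"
  using out_neighbours_nonempty by (simp add: walk_step_def)

text \<open>The extensions of a prefix by out-neighbours of its endpoint carry its whole mass, since
  the step probabilities sum to 1. Fixing the prefix \<open>x\<close> lets cylinders do the
  computation.\<close>

lemma AE_walk_step:
  assumes "x n \<in> verts G"
  shows "AE \<omega> in random_walk G u. (\<forall>i\<le>n. \<omega> i = x i) \<longrightarrow> x n \<rightarrow>\<^bsub>G\<^esub> \<omega> (Suc n)"
proof -
  interpret prob_space "random_walk G u"
    by (rule prob_space_random_walk)
  note S = sets_random_walk[of G u]
  let ?y = "\<lambda>y. x(Suc n := y)"
  let ?p = "\<lambda>y. pmf (walk_step G (x n)) y"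
  have cyl_Suc: "cylinder (Suc n) (?y y) = cylinder n x \<inter> {\<omega>. \<omega> (Suc n) = y}" for y
  proof -
    have "(\<forall>i\<le>Suc n. \<omega> i = ?y y i) \<longleftrightarrow> (\<forall>i\<le>n. \<omega> i = ?y y i) \<and> \<omega> (Suc n) = ?y y (Suc n)" for \<omega>
      by (simp only: le_Suc_eq) blast
    then show ?thesis
      by (auto simp: all_conj_distrib)
  qed
  have cyl: "emeasure (random_walk G u) (cylinder (Suc n) (?y y)) =
      emeasure (random_walk G u) (cylinder n x) * ennreal (?p y)" for y
  proof -
    have "(\<Prod>i<n. ennreal (pmf (walk_step G (?y y i)) (?y y (Suc i)))) =
      (\<Prod>i<n. ennreal (pmf (walk_step G (x i)) (x (Suc i))))"
      by (intro prod.cong) auto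
    then show ?thesis
      using emeasure_random_walk_cylinder[of G u "Suc n" "?y y"] emeasure_random_walk_cylinder[of G u n x]
      by simp
  qed
  have "cylinder n x \<inter> {\<omega>. \<omega> (Suc n) \<in> out_neighbours (x n)} =
      (\<Union>y\<in>out_neighbours (x n). cylinder (Suc n) (?y y))"
    unfolding cyl_Suc by blast
  moreover have "emeasure (random_walk G u) (\<Union>y\<in>out_neighbours (x n). cylinder (Suc n) (?y y)) =
      (\<Sum>y\<in>out_neighbours (x n). emeasure (random_walk G u) (cylinder (Suc n) (?y y)))"
  proof (intro sum_emeasure[symmetric] finite_out_neighbours)
    show "disjoint_family_on (\<lambda>y. cylinder (Suc n) (?y y)) (out_neighbours (x n))"
      unfolding disjoint_family_on_def cyl_Suc by blast
    show "(\<lambda>y. cylinder (Suc n) (?y y)) ` out_neighbours (x n) \<subseteq> sets (random_walk G u)"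
      using sets_cylinder[OF S] by blast
  qed
  ultimately have "emeasure (random_walk G u) (cylinder n x \<inter> {\<omega>. \<omega> (Suc n) \<in> out_neighbours (x n)}) =
      (\<Sum>y\<in>out_neighbours (x n). emeasure (random_walk G u) (cylinder (Suc n) (?y y)))"
    by simp
  also have "\<dots> = emeasure (random_walk G u) (cylinder n x) * ennreal (\<Sum>y\<in>out_neighbours (x n). ?p y)"
    unfolding cyl by (simp add: sum_distrib_left[symmetric] sum_ennreal)
  also have "(\<Sum>y\<in>out_neighbours (x n). ?p y) = 1"
    using assms by (intro sum_pmf_eq_1) (auto simp: set_pmf_walk_step)
  finally have "emeasure (random_walk G u) (cylinder n x \<inter> {\<omega>. \<omega> (Suc n) \<in> out_neighbours (x n)}) =
      emeasure (random_walk G u) (cylinder n x)"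
    by simp
  moreover define C where "C = cylinder n x"
  moreover define B where "B = {\<omega>. \<omega> (Suc n) \<in> out_neighbours (x n)}"
  ultimately have eq: "emeasure (random_walk G u) (C \<inter> B) = emeasure (random_walk G u) C"
    by simp
  have sets: "C \<in> sets (random_walk G u)" "B \<in> sets (random_walk G u)"
    unfolding C_def B_def by (rule sets_cylinder[OF S] sets_component_event[OF S])+
  then have "emeasure (random_walk G u) (C - C \<inter> B) = 0"
    by (subst emeasure_Diff) (simp_all add: eq)
  then have "AE \<omega> in random_walk G u. \<not> (\<omega> \<in> C - C \<inter> B)"
    using sets by (intro AE_I[where N="C - C \<inter> B"]) auto
  then show ?thesis
    unfolding C_def B_def by eventually_elim blast
qed

lemma AE_walk_start: "AE \<omega> in random_walk G u. \<omega> 0 = u"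
proof -
  interpret prob_space "random_walk G u"
    by (rule prob_space_random_walk)
  have "{\<omega>. \<omega> 0 = u} = cylinder 0 (\<lambda>_. u)"
    by auto
  then have "emeasure (random_walk G u) {\<omega>. \<omega> 0 = u} = 1"
    using emeasure_random_walk_cylinder[of G u 0 "\<lambda>_. u"] by simp
  then show ?thesis
    using sets_cylinder[OF sets_random_walk, of 0 "\<lambda>_. u" G u] prob_Collect_eq_1[of "\<lambda>\<omega>. \<omega> 0 = u"]
    by (simp add: emeasure_eq_measure)
qed

text \<open>Only finitely many prefixes of each length lie in \<open>verts G\<close>, so countably
  many null sets are discarded. Induction on time then keeps the walk in
  \<open>verts G\<close>.\<close>

lemma AE_walk:
  assumes "u \<in> verts G"
  shows "AE \<omega> in random_walk G u. \<omega> 0 = u \<and> (\<forall>n. \<omega> n \<rightarrow>\<^bsub>G\<^esub> \<omega> (Suc n))"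
proof -
  have "AE \<omega> in random_walk G u. \<forall>x\<in>PiE {..n} (\<lambda>_. verts G).
      (\<forall>i\<le>n. \<omega> i = x i) \<longrightarrow> x n \<rightarrow>\<^bsub>G\<^esub> \<omega> (Suc n)" for n
    by (intro AE_finite_allI finite_PiE AE_walk_step) auto
  then have "AE \<omega> in random_walk G u. \<forall>n. \<forall>x\<in>PiE {..n} (\<lambda>_. verts G).
      (\<forall>i\<le>n. \<omega> i = x i) \<longrightarrow> x n \<rightarrow>\<^bsub>G\<^esub> \<omega> (Suc n)"
    by (simp add: AE_all_countable)
  with AE_walk_start[of u] show ?thesis
  proof eventually_elim
    case (elim \<omega>)
    have step: "\<omega> n \<rightarrow>\<^bsub>G\<^esub> \<omega> (Suc n)" if "\<forall>i\<le>n. \<omega> i \<in> verts G" for n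
    proof -
      have "restrict \<omega> {..n} \<in> PiE {..n} (\<lambda>_. verts G)"
        using that by simp
      moreover have "\<forall>i\<le>n. \<omega> i = restrict \<omega> {..n} i"
        by simp
      ultimately have "restrict \<omega> {..n} n \<rightarrow>\<^bsub>G\<^esub> \<omega> (Suc n)"
        using elim(2) by blast
      then show ?thesis
        by simp
    qed
    have "\<forall>i\<le>n. \<omega> i \<in> verts G" for n
    proof (induction n)
      case (Suc n)
      then show ?case
        using step[of n] adj_in_verts by (auto simp: le_Suc_eq)
    qed (simp add: elim assms)
    then show ?case
      using step elim by auto
  qed
qed

lemma AE_walk_verts:
  assumes "u \<in> verts G"
  shows "AE \<omega> in random_walk G u. \<forall>n. \<omega> n \<in> verts G"
  using AE_walk[OF assms] by eventually_elim (blast intro: adj_in_verts)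

text \<open>This is the Markov property at time 1. The product formula for a cylinder splits off its
  first factor, so both laws agree on cylinders.\<close>

lemma random_walk_first_step:
  assumes "u \<in> verts G"
  shows "random_walk G u = measure_pmf (walk_step G u) \<bind>
    (\<lambda>x. distr (random_walk G x) (PiM UNIV (\<lambda>_. count_space UNIV)) (case_nat u))"
proof -
  let ?P = "PiM UNIV (\<lambda>_. count_space UNIV) :: (nat \<Rightarrow> 'a) measure"
  let ?K = "\<lambda>x. distr (random_walk G x) ?P (case_nat u)"
  have cn[measurable]: "case_nat u \<in> random_walk G x \<rightarrow>\<^sub>M ?P" for x
    using measurable_case_nat_path by (simp cong: measurable_cong_sets add: sets_random_walk)
  have prob: "prob_space (?K x)" for x
    by (intro prob_space.prob_space_distr prob_space_random_walk) simp
  have K: "?K \<in> measure_pmf (walk_step G u) \<rightarrow>\<^sub>M subprob_algebra ?P"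
    using prob by (auto simp: space_subprob_algebra prob_space_imp_subprob_space)
  have sets: "sets (measure_pmf (walk_step G u) \<bind> ?K) = sets ?P"
    by (rule sets_bind) auto
  show ?thesis
  proof (rule measure_eqI_cylinders[OF sets_random_walk sets finite_verts AE_walk_verts[OF assms]])
    have "AE \<omega> in ?K x. \<forall>i. \<omega> i \<in> verts G" if "x \<in> out_neighbours u" for x
    proof -
      have "AE \<omega> in random_walk G x. \<forall>i. case_nat u \<omega> i \<in> verts G"
        using AE_walk_verts[of x] that adj_in_verts(2) assms by (auto split: nat.split)
      then show ?thesis
        using sets_pointwise_event[of ?P "\<lambda>_. verts G"]
        by (subst AE_distr_iff) (auto simp: space_PiM)
    qed
    then show "AE \<omega> in measure_pmf (walk_step G u) \<bind> ?K. \<forall>i. \<omega> i \<in> verts G"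
      using assms sets_pointwise_event[of ?P "\<lambda>_. verts G"]
      by (subst AE_bind[OF K]) (auto simp: AE_measure_pmf_iff set_pmf_walk_step pred_def space_PiM)
  next
    fix n and x :: "nat \<Rightarrow> 'a"
    have "emeasure (measure_pmf (walk_step G u) \<bind> ?K) (cylinder n x) =
        (\<integral>\<^sup>+y. emeasure (?K y) (cylinder n x) \<partial>walk_step G u)"
      by (intro emeasure_bind[OF _ K] sets_cylinder) auto
    also have "\<dots> = (\<integral>\<^sup>+y. emeasure (random_walk G y) (case_nat u -` cylinder n x) \<partial>walk_step G u)"
      using sets_cylinder[of ?P] by (simp add: emeasure_distr)
    also have "\<dots> = emeasure (random_walk G u) (cylinder n x)"
    proof (cases n)
      case 0
      have "case_nat u -` cylinder 0 x = (if x 0 = u then UNIV else {})"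
        by auto
      then show ?thesis
        using emeasure_random_walk_cylinder[of G u 0 x] prob_space.emeasure_space_1[OF prob_space_random_walk, of G]
        by (simp add: 0)
    next
      case (Suc m)
      have *: "case_nat u -` cylinder n x = (if x 0 = u then cylinder m (\<lambda>i. x (Suc i)) else {})"
        unfolding Suc less_Suc_eq_le[symmetric] All_less_Suc2 by auto
      \<comment> \<open>The requirement that the walk from \<open>y\<close> start at
        \<open>x 1\<close> moves into the indicator, so \<open>c\<close> does not depend on
        \<open>y\<close>.\<close>
      define c where "c = (if x 0 = u then \<Prod>i<m. ennreal (pmf (walk_step G (x (Suc i))) (x (Suc (Suc i)))) else 0)"
      have "(\<integral>\<^sup>+y. emeasure (random_walk G y) (case_nat u -` cylinder n x) \<partial>walk_step G u) =
          (\<integral>\<^sup>+y. c * indicator {x 1} y \<partial>walk_step G u)"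
        unfolding * c_def by (intro nn_integral_cong) (auto simp: emeasure_random_walk_cylinder)
      also have "\<dots> = c * ennreal (pmf (walk_step G u) (x 1))"
        by (simp add: nn_integral_cmult_indicator emeasure_pmf_single)
      also have "\<dots> = emeasure (random_walk G u) (cylinder n x)"
        unfolding emeasure_random_walk_cylinder Suc c_def prod.lessThan_Suc_shift by (simp add: mult.commute)
      finally show ?thesis .
    qed
    finally show "emeasure (random_walk G u) (cylinder n x) =
        emeasure (measure_pmf (walk_step G u) \<bind> ?K) (cylinder n x)" ..
  qed (rule prob_space.finite_measure[OF prob_space_random_walk])
qed

text \<open>The first step averages uniformly over the out-neighbours; multiplying by their number
  avoids division.\<close>

lemma walk_prob_first_step:
  assumes "u \<in> verts G" and E: "E \<in> sets (PiM UNIV (\<lambda>_. count_space UNIV))"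
  shows "card (out_neighbours u) * walk_prob u E = (\<Sum>x\<in>out_neighbours u. walk_prob x (case_nat u -` E))"
proof -
  let ?P = "PiM UNIV (\<lambda>_. count_space UNIV) :: (nat \<Rightarrow> 'a) measure"
  let ?K = "\<lambda>x. distr (random_walk G x) ?P (case_nat u)"
  let ?N = "out_neighbours u"
  interpret prob_space "random_walk G x" for x
    by (rule prob_space_random_walk)
  have cn: "case_nat u \<in> random_walk G x \<rightarrow>\<^sub>M ?P" for x
    using measurable_case_nat_path by (simp cong: measurable_cong_sets add: sets_random_walk)
  have K: "?K \<in> measure_pmf (walk_step G u) \<rightarrow>\<^sub>M subprob_algebra ?P"
    using prob_space_distr[OF cn] by (auto simp: space_subprob_algebra prob_space_imp_subprob_space)
  have N: "finite ?N" "?N \<noteq> {}"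
    using out_neighbours_nonempty[OF assms(1)] by auto
  have "ennreal (walk_prob u E) = (\<integral>\<^sup>+x. emeasure (?K x) E \<partial>walk_step G u)"
    by (subst emeasure_eq_measure[symmetric], subst random_walk_first_step[OF assms(1)])
      (intro emeasure_bind[OF _ K E], simp)
  also have "\<dots> = (\<integral>\<^sup>+x. ennreal (walk_prob x (case_nat u -` E)) \<partial>walk_step G u)"
    by (simp add: emeasure_distr[OF cn E] emeasure_eq_measure)
  also have "\<dots> = ennreal ((\<Sum>x\<in>?N. walk_prob x (case_nat u -` E)) / card ?N)"
    using N unfolding walk_step_def
    by (simp add: nn_integral_pmf_of_set divide_ennreal[symmetric] ennreal_of_nat_eq_real_of_nat
        card_gt_0_iff sum_nonneg)
  finally have "walk_prob u E = (\<Sum>x\<in>?N. walk_prob x (case_nat u -` E)) / card ?N"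
    by (simp add: sum_nonneg)
  then show ?thesis
    using N by simp
qed

text \<open>Almost every trajectory is a walk from \<open>u\<close>, so an event of positive
  probability contains one.\<close>

lemma walk_of_positive_prob:
  assumes "u \<in> verts G" and "walk_prob u E > 0"
  obtains \<omega> where "\<omega> \<in> E" "\<omega> 0 = u" "\<And>n. \<omega> n \<rightarrow>\<^bsub>G\<^esub> \<omega> (Suc n)"
proof (rule ccontr)
  note witness = that
  assume "\<not> thesis"
  then have *: "\<omega> \<notin> E" if "\<omega> 0 = u \<and> (\<forall>n. \<omega> n \<rightarrow>\<^bsub>G\<^esub> \<omega> (Suc n))" for \<omega>
    using that witness by blast
  \<comment> \<open>\<open>measure\<close> is 0 outside the sigma-algebra, so positivity already
    gives measurability.\<close>
  have "E \<in> sets (random_walk G u)"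
    using assms(2) by (metis less_irrefl measure_notin_sets)
  moreover have "AE \<omega> in random_walk G u. \<omega> \<notin> E"
    using AE_walk[OF assms(1)] by eventually_elim (rule *)
  ultimately have "emeasure (random_walk G u) E = 0"
    by (subst AE_iff_measurable[symmetric, where P="\<lambda>\<omega>. \<omega> \<notin> E"]) auto
  then show False
    using assms(2) by (simp add: measure_def)
qed

text \<open>Every transition along a finite walk has positive probability, so its cylinder cannot
  lie inside a null event.\<close>

lemma path_avoiding_null_event:
  assumes E: "E \<in> sets (random_walk G u)" "walk_prob u E = 0"
    and xs: "xs \<noteq> []" "hd xs = u" "successively (\<lambda>a b. a \<rightarrow>\<^bsub>G\<^esub> b) xs"
  obtains \<omega> where "\<omega> \<notin> E" "\<And>i. i < length xs \<Longrightarrow> \<omega> i = xs ! i"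
proof (rule ccontr)
  interpret prob_space "random_walk G u"
    by (rule prob_space_random_walk)
  define n where "n = length xs - 1"
  have len: "length xs = Suc n"
    using xs(1) by (simp add: n_def)
  note witness = that
  assume "\<not> thesis"
  then have "\<omega> \<in> E" if "\<forall>i\<le>n. \<omega> i = xs ! i" for \<omega>
    using that witness by (metis len less_Suc_eq_le)
  then have "cylinder n ((!) xs) \<subseteq> E"
    by blast
  then have "emeasure (random_walk G u) (cylinder n ((!) xs)) = 0"
    using E by (metis emeasure_eq_0 emeasure_eq_measure ennreal_0)
  then have "(\<Prod>i<n. ennreal (pmf (walk_step G (xs ! i)) (xs ! Suc i))) = 0"
    using xs by (simp add: emeasure_random_walk_cylinder hd_conv_nth)
  then obtain i where i: "i < n" "pmf (walk_step G (xs ! i)) (xs ! Suc i) = 0"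
    by (auto simp: ennreal_eq_0_iff order.antisym)
  then have "xs ! i \<rightarrow>\<^bsub>G\<^esub> xs ! Suc i"
    using xs(3) len by (simp add: successively_conv_nth)
  moreover from this have "xs ! Suc i \<in> set_pmf (walk_step G (xs ! i))"
    using adj_in_verts(1) by (subst set_pmf_walk_step) auto
  ultimately show False
    using i(2) by (simp add: set_pmf_iff)
qed

end

section \<open>Strongly connected digraphs\<close>

text \<open>A second vertex lets strong connectivity supply out-neighbours and keeps a tour from
  ending where it starts.\<close>

locale nontrivial_strong_digraph = digraph +
  assumes strong: "strongly_connected G"
    and two_verts: "\<exists>u\<in>verts G. \<exists>v\<in>verts G. u \<noteq> v"
begin

lemma other_vertex: "v \<in> verts G \<Longrightarrow> \<exists>w\<in>verts G. w \<noteq> v"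
  using two_verts by metis

end

sublocale nontrivial_strong_digraph \<subseteq> walkable_digraph
proof
  fix v assume v: "v \<in> verts G"
  obtain w where w: "w \<in> verts G" "w \<noteq> v"
    using other_vertex[OF v] by blast
  then have "(v, w) \<in> (arcs_ends G)\<^sup>*"
    using v strong reachable_rtranclI unfolding strongly_connected_def by metis
  then show "\<exists>w. v \<rightarrow>\<^bsub>G\<^esub> w"
    using w(2) by (auto elim: converse_rtranclE)
qed

section \<open>Finite walks as lists of vertices\<close>

lemma rtrancl_on_imp_successively:
  assumes "(a, b) \<in> rtrancl_on F r"
  obtains xs where "xs \<noteq> []" "hd xs = a" "last xs = b" "set xs \<subseteq> F"
    "successively (\<lambda>x y. (x, y) \<in> r) xs"
proof -
  have "\<exists>xs. xs \<noteq> [] \<and> hd xs = a \<and> last xs = b \<and> set xs \<subseteq> F \<and> successively (\<lambda>x y. (x, y) \<in> r) xs"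
    using assms
  proof (induction rule: rtrancl_on_induct)
    case base
    then show ?case
      by (intro exI[of _ "[a]"]) auto
  next
    case (step y z)
    then obtain xs where "xs \<noteq> []" "hd xs = a" "last xs = y" "set xs \<subseteq> F"
      "successively (\<lambda>x y. (x, y) \<in> r) xs"
      by blast
    with step show ?case
      by (intro exI[of _ "xs @ [z]"]) (auto simp: successively_append_iff)
  qed
  then show ?thesis
    using that by blast
qed

text \<open>\<open>tl ys\<close> drops the shared vertex, which would otherwise occur twice in a
  row.\<close>

lemma successively_join:
  assumes "successively R xs" "successively R ys" "xs \<noteq> []" "ys \<noteq> []" "last xs = hd ys"
  shows "successively R (xs @ tl ys)" "hd (xs @ tl ys) = hd xs" "last (xs @ tl ys) = last ys"
    "set (xs @ tl ys) = set xs \<union> set ys"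
proof -
  obtain y ys' where ys: "ys = y # ys'"
    using assms(4) by (cases ys) auto
  have "y \<in> set xs"
    using assms by (metis last_in_set list.sel(1) ys)
  then show "set (xs @ tl ys) = set xs \<union> set ys"
    by (auto simp: ys)
  show "successively R (xs @ tl ys)" "hd (xs @ tl ys) = hd xs" "last (xs @ tl ys) = last ys"
    using assms by (auto simp: ys successively_append_iff successively_Cons)
qed

section \<open>Covering probabilities and first-step analysis\<close>

context nontrivial_strong_digraph
begin

abbreviation last_prob :: "'a \<Rightarrow> 'a \<Rightarrow> real" where
  "last_prob u v \<equiv> walk_prob u (cover_tour_ends_at G v)"

text \<open>Minimum principle: where \<open>f\<close> is minimal, an average over out-neighbours
  that is no larger forces each of them to be minimal too, and strong connectivity spreads this to
  all vertices.\<close>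

lemma constant_if_superharmonic:
  fixes f :: "'a \<Rightarrow> real"
  assumes super: "\<And>u. u \<in> verts G \<Longrightarrow> (\<Sum>x\<in>out_neighbours u. f x) \<le> card (out_neighbours u) * f u"
  shows "\<exists>c. \<forall>u\<in>verts G. f u = c"
proof -
  define m where "m = Min (f ` verts G)"
  have ne: "verts G \<noteq> {}"
    using two_verts by auto
  have m: "m \<le> f x" if "x \<in> verts G" for x
    using that by (simp add: m_def)
  have "m \<in> f ` verts G"
    unfolding m_def using ne by (intro Min_in) auto
  then obtain u where u: "u \<in> verts G" "f u = m"
    by auto
  have "f v = m" if "v \<in> verts G" for v
  proof -
    have "u \<rightarrow>\<^sup>*\<^bsub>G\<^esub> v"
      using strong u that by (auto simp: strongly_connected_def)
    then show ?thesis
    proof (induction rule: reachable_induct)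
      case (step x y)
      have "f y - m \<le> (\<Sum>z\<in>out_neighbours x. f z - m)"
        using step.hyps(2) m adj_in_verts(2) by (intro member_le_sum) auto
      also have "\<dots> \<le> 0"
        using super[of x] step.hyps(2) adj_in_verts(1) step.IH by (simp add: sum_subtractf)
      finally show ?case
        using m[of y] step.hyps(2) adj_in_verts(2) by fastforce
    qed (rule u)
  qed
  then show ?thesis
    by blast
qed

lemma covering_path_exists:
  assumes "u \<in> verts G"
  obtains xs where "xs \<noteq> []" "hd xs = u" "verts G \<subseteq> set xs" "successively (\<lambda>a b. a \<rightarrow>\<^bsub>G\<^esub> b) xs"
proof -
  \<comment> \<open>The vertices are collected one at a time; \<open>last xs \<in> verts G\<close>
    is carried along so that the walk can be prolonged.\<close>
  have "\<exists>xs. xs \<noteq> [] \<and> hd xs = u \<and> last xs \<in> verts G \<and> S \<subseteq> set xs \<and> successively (\<lambda>a b. a \<rightarrow>\<^bsub>G\<^esub> b) xs"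
    if "finite S" "S \<subseteq> verts G" for S
    using that
  proof (induction S rule: finite_induct)
    case empty
    show ?case
      using assms by (intro exI[of _ "[u]"]) auto
  next
    case (insert v S)
    then obtain xs where xs: "xs \<noteq> []" "hd xs = u" "last xs \<in> verts G" "S \<subseteq> set xs"
      "successively (\<lambda>a b. a \<rightarrow>\<^bsub>G\<^esub> b) xs"
      by auto
    have "(last xs, v) \<in> rtrancl_on (verts G) (arcs_ends G)"
      using strong xs(3) insert.prems by (simp add: strongly_connected_def reachable_def)
    then obtain ys where ys: "ys \<noteq> []" "hd ys = last xs" "last ys = v"
      "successively (\<lambda>a b. a \<rightarrow>\<^bsub>G\<^esub> b) ys"
      by (rule rtrancl_on_imp_successively)
    note join = successively_join[OF xs(5) ys(4) xs(1) ys(1) ys(2)[symmetric]]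
    have "v \<in> set ys"
      using ys by (metis last_in_set)
    with join show ?case
      using xs ys(3) insert.prems by (intro exI[of _ "xs @ tl ys"]) auto
  qed
  from this[of "verts G"] show ?thesis
    using that by auto
qed

lemma sets_cover_tour_ends_at_PiM:
  "cover_tour_ends_at G v \<in> sets (PiM UNIV (\<lambda>_. count_space UNIV))"
  using sets_cover_tour_ends_at[of G v] by (simp add: sets_random_walk)

lemma sets_shift:
  assumes "E \<in> sets (PiM UNIV (\<lambda>_. count_space UNIV))"
  shows "case_nat u -` E \<in> sets (random_walk G x)"
  using measurable_sets[OF measurable_case_nat_path assms, of u] by (simp add: sets_random_walk space_PiM)

text \<open>The start counts as visited at time 0, so a tour ending there would have seen only
  \<open>u\<close>.\<close>

lemma last_prob_self:
  assumes "u \<in> verts G"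
  shows "last_prob u u = 0"
proof (rule ccontr)
  assume "last_prob u u \<noteq> 0"
  then have "last_prob u u > 0"
    by (simp add: zero_less_measure_iff)
  then obtain \<omega> where \<omega>: "\<omega> \<in> cover_tour_ends_at G u" "\<omega> 0 = u"
    by (rule walk_of_positive_prob[OF assms])
  then obtain T where T: "\<forall>i<T. \<omega> i \<noteq> u" "verts G \<subseteq> \<omega> ` {..T}"
    by (auto simp: mem_cover_tour_ends_at_iff[OF assms])
  with \<omega> have "T = 0"
    by (metis gr0I)
  with T \<omega> have "verts G \<subseteq> {u}"
    by simp
  then show False
    using two_verts by blast
qed

lemma cover_prob_eq_sum:
  "walk_prob u {\<omega>. \<exists>n. covered_by G \<omega> n} = (\<Sum>v\<in>verts G. last_prob u v)"
proof -
  interpret prob_space "random_walk G u"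
    by (rule prob_space_random_walk)
  have "verts G \<noteq> {}"
    using two_verts by auto
  show ?thesis
    unfolding cover_tour_ends_at_UN[OF \<open>verts G \<noteq> {}\<close>, symmetric]
    using sets_cover_tour_ends_at[of G]
    by (intro finite_measure_finite_Union) (auto simp: disjoint_family_on_def cover_tour_ends_at_def)
qed

text \<open>Superharmonicity gives constancy, and a finite covering walk gives positivity.\<close>

lemma cover_prob_constant:
  "\<exists>c>0. \<forall>u\<in>verts G. walk_prob u {\<omega>. \<exists>n. covered_by G \<omega> n} = c"
proof -
  let ?K = "{\<omega>. \<exists>n. covered_by G \<omega> n}"
  have ne: "verts G \<noteq> {}"
    using two_verts by auto
  have K: "?K \<in> sets (PiM UNIV (\<lambda>_. count_space UNIV))"
    unfolding cover_tour_ends_at_UN[OF ne, symmetric]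
    by (intro sets.finite_UN sets_cover_tour_ends_at_PiM) simp
  \<comment> \<open>Prepending \<open>u\<close> preserves covering; summed over first steps, this is
    the superharmonic inequality.\<close>
  have "?K \<subseteq> case_nat u -` ?K" for u
  proof
    fix \<omega> assume "\<omega> \<in> ?K"
    then obtain n where "verts G \<subseteq> \<omega> ` {..n}"
      by (auto simp: covered_by_def)
    also have "\<omega> ` {..n} \<subseteq> case_nat u \<omega> ` {..Suc n}"
      unfolding image_case_nat_atMost by blast
    finally show "\<omega> \<in> case_nat u -` ?K"
      by (auto simp: covered_by_def)
  qed
  then have "walk_prob x ?K \<le> walk_prob x (case_nat u -` ?K)" for x u
    by (intro finite_measure.finite_measure_mono sets_shift K)
      (auto intro: prob_space.finite_measure prob_space_random_walk)
  then have "\<exists>c. \<forall>u\<in>verts G. walk_prob u ?K = c"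
    by (intro constant_if_superharmonic) (simp add: walk_prob_first_step K sum_mono)
  then obtain c where c: "\<forall>u\<in>verts G. walk_prob u ?K = c"
    by blast
  obtain u where u: "u \<in> verts G"
    using ne by blast
  obtain xs where xs: "xs \<noteq> []" "hd xs = u" "verts G \<subseteq> set xs" "successively (\<lambda>a b. a \<rightarrow>\<^bsub>G\<^esub> b) xs"
    using covering_path_exists[OF u] .
  have "walk_prob u ?K \<noteq> 0"
  proof
    assume "walk_prob u ?K = 0"
    then obtain \<omega> where \<omega>: "\<omega> \<notin> ?K" "\<And>i. i < length xs \<Longrightarrow> \<omega> i = xs ! i"
      using path_avoiding_null_event[OF _ _ xs(1,2,4), of ?K] K by (auto simp: sets_random_walk)
    have "v \<in> \<omega> ` {..length xs}" if "v \<in> verts G" for v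
      using that xs(3) \<omega>(2) by (metis atMost_iff image_eqI in_set_conv_nth less_imp_le subsetD)
    then show False
      using \<omega>(1) by (auto simp: covered_by_def)
  qed
  then have "c > 0"
    using c u by (metis zero_less_measure_iff)
  then show ?thesis
    using c by blast
qed

text \<open>The tail misses ending at \<open>v\<close> on its own only because it has not met
  \<open>u\<close> before \<open>v\<close>, and \<open>u\<close> is exactly what the prepended start
  supplies. The probability of this event from \<open>x\<close> is \<open>q(x)\<close>.\<close>

lemma shift_minus_cover_tour_iff:
  assumes "u \<in> verts G" "v \<in> verts G" "u \<noteq> v"
  shows "\<omega> \<in> case_nat u -` cover_tour_ends_at G v - cover_tour_ends_at G v \<longleftrightarrow>
    (\<exists>T. \<omega> T = v \<and> (\<forall>i<T. \<omega> i \<noteq> u \<and> \<omega> i \<noteq> v) \<and> verts G - {u, v} \<subseteq> \<omega> ` {..<T})"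
    (is "_ \<longleftrightarrow> ?R")
proof
  assume *: "\<omega> \<in> case_nat u -` cover_tour_ends_at G v - cover_tour_ends_at G v"
  then obtain T' where T': "case_nat u \<omega> T' = v" "\<forall>i<T'. case_nat u \<omega> i \<noteq> v" "verts G \<subseteq> case_nat u \<omega> ` {..T'}"
    by (auto simp: mem_cover_tour_ends_at_iff[OF assms(2)])
  then obtain T where T: "T' = Suc T"
    using assms(3) by (cases T') auto
  have v: "\<omega> T = v" "\<forall>i<T. \<omega> i \<noteq> v"
    using T' T by force+
  have cov: "verts G - {u} \<subseteq> \<omega> ` {..T}"
    using T'(3) unfolding T image_case_nat_atMost by blast
  \<comment> \<open>Only \<open>u\<close> can be missing by time \<open>T\<close>; if it were not,
    the tail's own tour would end at \<open>v\<close>.\<close>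
  have "\<not> verts G \<subseteq> \<omega> ` {..T}"
    using * v mem_cover_tour_ends_at_iff[OF assms(2), of \<omega>] by (metis DiffD2)
  then have "u \<notin> \<omega> ` {..T}"
    using cov by blast
  moreover have "\<omega> ` {..T} = insert v (\<omega> ` {..<T})"
    using v by (simp add: lessThan_Suc_atMost[symmetric] lessThan_Suc)
  ultimately show ?R
    using v cov by (intro exI[of _ T]) blast
next
  assume ?R
  then obtain T where T: "\<omega> T = v" "\<forall>i<T. \<omega> i \<noteq> u \<and> \<omega> i \<noteq> v" "verts G - {u, v} \<subseteq> \<omega> ` {..<T}"
    by blast
  have "verts G \<subseteq> case_nat u \<omega> ` {..Suc T}"
    unfolding image_case_nat_atMost using T(1,3)
    by (auto simp: lessThan_Suc_atMost[symmetric] lessThan_Suc)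
  moreover have "\<forall>i<Suc T. case_nat u \<omega> i \<noteq> v"
    using T(2) assms(3) by (auto split: nat.split)
  ultimately have "case_nat u \<omega> \<in> cover_tour_ends_at G v"
    using T(1) by (auto simp: mem_cover_tour_ends_at_iff[OF assms(2)] intro!: exI[of _ "Suc T"])
  moreover have "\<omega> \<notin> cover_tour_ends_at G v"
  proof
    assume "\<omega> \<in> cover_tour_ends_at G v"
    then obtain S where S: "\<omega> S = v" "\<forall>i<S. \<omega> i \<noteq> v" "verts G \<subseteq> \<omega> ` {..S}"
      by (auto simp: mem_cover_tour_ends_at_iff[OF assms(2)])
    have "S = T"
      using S(1,2) T(1,2) by (metis linorder_neqE_nat)
    with S(3) assms(1) obtain i where "i \<le> T" "\<omega> i = u"
      by auto
    with T(1,2) assms(3) show False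
      by (metis order_le_imp_less_or_eq)
  qed
  ultimately show "\<omega> \<in> case_nat u -` cover_tour_ends_at G v - cover_tour_ends_at G v"
    by simp
qed

text \<open>As \<open>u \<noteq> v\<close>, prepending \<open>u\<close> does not create an earlier
  visit to \<open>v\<close>. The inclusion turns \<open>q(x)\<close> into a difference of
  probabilities.\<close>

lemma cover_tour_subset_shift:
  assumes "v \<in> verts G" "u \<noteq> v"
  shows "cover_tour_ends_at G v \<subseteq> case_nat u -` cover_tour_ends_at G v"
proof
  fix \<omega> assume "\<omega> \<in> cover_tour_ends_at G v"
  then obtain T where T: "\<omega> T = v" "\<forall>i<T. \<omega> i \<noteq> v" "verts G \<subseteq> \<omega> ` {..T}"
    by (auto simp: mem_cover_tour_ends_at_iff[OF assms(1)])
  have "verts G \<subseteq> case_nat u \<omega> ` {..Suc T}"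
    unfolding image_case_nat_atMost using T(3) by blast
  moreover have "\<forall>i<Suc T. case_nat u \<omega> i \<noteq> v"
    using T(2) assms(2) by (auto split: nat.split)
  ultimately show "\<omega> \<in> case_nat u -` cover_tour_ends_at G v"
    using T(1) by (auto simp: mem_cover_tour_ends_at_iff[OF assms(1)] intro!: exI[of _ "Suc T"])
qed

lemma walk_prob_shift_minus:
  assumes "v \<in> verts G" "u \<noteq> v"
  shows "walk_prob x (case_nat u -` cover_tour_ends_at G v - cover_tour_ends_at G v) =
    walk_prob x (case_nat u -` cover_tour_ends_at G v) - last_prob x v"
  by (intro finite_measure.finite_measure_Diff cover_tour_subset_shift assms sets_shift
      sets_cover_tour_ends_at_PiM sets_cover_tour_ends_at finite_verts)
    (auto intro: prob_space.finite_measure prob_space_random_walk)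

end

section \<open>Uniform last vertices\<close>

locale uniform_cover_digraph = nontrivial_strong_digraph +
  assumes uniform: "\<lbrakk>u \<in> verts G; v \<in> verts G; w \<in> verts G; u \<noteq> v; u \<noteq> w; v \<noteq> w\<rbrakk>
    \<Longrightarrow> last_prob u v = last_prob u w"
begin

text \<open>For each start \<open>u\<close> the values \<open>last_prob u v\<close> sum to the same
  \<open>c\<close>; the term at \<open>u\<close> is 0 and the others are equal, so each is
  \<open>c\<close> divided by the number of other vertices.\<close>

lemma last_prob_constant:
  obtains p where "p > 0" "\<And>u v. \<lbrakk>u \<in> verts G; v \<in> verts G; u \<noteq> v\<rbrakk> \<Longrightarrow> last_prob u v = p"
proof -
  obtain c where c: "c > 0" "\<forall>u\<in>verts G. walk_prob u {\<omega>. \<exists>n. covered_by G \<omega> n} = c"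
    using cover_prob_constant by blast
  have "c = card (verts G - {u}) * last_prob u v"
    if uv: "u \<in> verts G" "v \<in> verts G" "u \<noteq> v" for u v
  proof -
    have "c = (\<Sum>w\<in>verts G. last_prob u w)"
      using c(2) uv(1) cover_prob_eq_sum by simp
    also have "\<dots> = (\<Sum>w\<in>verts G - {u}. last_prob u w)"
      using uv(1) by (simp add: sum.remove[of "verts G" u] last_prob_self)
    also have "\<dots> = (\<Sum>w\<in>verts G - {u}. last_prob u v)"
    proof (intro sum.cong refl)
      fix w assume "w \<in> verts G - {u}"
      then show "last_prob u w = last_prob u v"
        using uniform[of u w v] uv by (cases "w = v") auto
    qed
    finally show ?thesis
      by simp
  qed
  then have *: "c = (card (verts G) - 1) * last_prob u v"
    if "u \<in> verts G" "v \<in> verts G" "u \<noteq> v" for u v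
    using that by (metis card_Diff_singleton)
  have n: "real (card (verts G) - 1) > 0"
  proof (rule ccontr)
    assume "\<not> real (card (verts G) - 1) > 0"
    then have "real (card (verts G) - 1) = 0"
      by simp
    moreover obtain u v where "u \<in> verts G" "v \<in> verts G" "u \<noteq> v"
      using two_verts by blast
    ultimately show False
      using *[of u v] c(1) by simp
  qed
  show ?thesis
  proof (rule that[of "c / (card (verts G) - 1)"])
    show "c / real (card (verts G) - 1) > 0"
      using c(1) n by simp
    show "last_prob u v = c / real (card (verts G) - 1)" if "u \<in> verts G" "v \<in> verts G" "u \<noteq> v" for u v
      using *[OF that] n by (simp add: field_simps)
  qed
qed

text \<open>Every out-neighbour \<open>x\<close> of \<open>u\<close> differs from \<open>v\<close>,
  so the terms \<open>last_prob x v = p\<close> already account for the whole first-step sum and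
  leave nothing for \<open>q\<close>.\<close>

lemma shift_minus_null_if_no_arc:
  assumes "u \<in> verts G" "v \<in> verts G" "u \<noteq> v" "\<not> u \<rightarrow>\<^bsub>G\<^esub> v" "u \<rightarrow>\<^bsub>G\<^esub> x"
  shows "walk_prob x (case_nat u -` cover_tour_ends_at G v - cover_tour_ends_at G v) = 0"
proof -
  obtain p where p: "\<And>u v. \<lbrakk>u \<in> verts G; v \<in> verts G; u \<noteq> v\<rbrakk> \<Longrightarrow> last_prob u v = p"
    using last_prob_constant by metis
  let ?q = "\<lambda>x. walk_prob x (case_nat u -` cover_tour_ends_at G v - cover_tour_ends_at G v)"
  have "(\<Sum>x\<in>out_neighbours u. ?q x) =
      (\<Sum>x\<in>out_neighbours u. walk_prob x (case_nat u -` cover_tour_ends_at G v)) - (\<Sum>x\<in>out_neighbours u. last_prob x v)"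
    by (simp add: walk_prob_shift_minus assms sum_subtractf)
  also have "(\<Sum>x\<in>out_neighbours u. walk_prob x (case_nat u -` cover_tour_ends_at G v)) = card (out_neighbours u) * p"
    using walk_prob_first_step[OF assms(1) sets_cover_tour_ends_at_PiM, of v] p assms by simp
  also have "(\<Sum>x\<in>out_neighbours u. last_prob x v) = (\<Sum>x\<in>out_neighbours u. p)"
    using assms(2,4) adj_in_verts(2) by (intro sum.cong p) auto
  finally have "(\<Sum>x\<in>out_neighbours u. ?q x) = 0"
    by simp
  then show ?thesis
    using assms(5) by (subst (asm) sum_nonneg_eq_0_iff) auto
qed

text \<open>The out-neighbour \<open>v\<close> contributes 0 to the sum of the
  \<open>last_prob x v\<close>, so that sum falls short by one \<open>p\<close>, and some
  \<open>q(x)\<close> must make up for it. The third vertex \<open>w\<close> rules out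
  \<open>x = v\<close>.\<close>

lemma shift_minus_pos_if_arc:
  assumes uv: "u \<in> verts G" "v \<in> verts G" "u \<noteq> v" "u \<rightarrow>\<^bsub>G\<^esub> v"
    and w: "w \<in> verts G" "w \<noteq> u" "w \<noteq> v"
  obtains x where "u \<rightarrow>\<^bsub>G\<^esub> x" "x \<noteq> v"
    "walk_prob x (case_nat u -` cover_tour_ends_at G v - cover_tour_ends_at G v) > 0"
proof (rule ccontr)
  let ?q = "\<lambda>x. walk_prob x (case_nat u -` cover_tour_ends_at G v - cover_tour_ends_at G v)"
  note witness = that
  assume "\<not> thesis"
  then have q0: "?q x = 0" if "u \<rightarrow>\<^bsub>G\<^esub> x" "x \<noteq> v" for x
    using that witness by (metis zero_less_measure_iff)
  \<comment> \<open>From \<open>v\<close>, the first visit to \<open>v\<close> is at time 0, before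
    \<open>w\<close> can have been seen.\<close>
  have qv: "?q v = 0"
  proof (rule ccontr)
    assume "?q v \<noteq> 0"
    then have "?q v > 0"
      by (simp add: zero_less_measure_iff)
    then obtain \<omega> where "\<omega> \<in> case_nat u -` cover_tour_ends_at G v - cover_tour_ends_at G v" "\<omega> 0 = v"
      by (rule walk_of_positive_prob[OF uv(2)])
    then obtain T where T: "\<forall>i<T. \<omega> i \<noteq> v" "verts G - {u, v} \<subseteq> \<omega> ` {..<T}" "\<omega> 0 = v"
      unfolding shift_minus_cover_tour_iff[OF uv(1-3)] by blast
    then have "T = 0"
      by (metis gr0I)
    with T w show False
      by auto
  qed
  obtain p where p: "p > 0" "\<And>u v. \<lbrakk>u \<in> verts G; v \<in> verts G; u \<noteq> v\<rbrakk> \<Longrightarrow> last_prob u v = p"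
    using last_prob_constant by metis
  have "card (out_neighbours u) * p =
      (\<Sum>x\<in>out_neighbours u. walk_prob x (case_nat u -` cover_tour_ends_at G v))"
    using walk_prob_first_step[OF uv(1) sets_cover_tour_ends_at_PiM, of v] p uv by simp
  also have "\<dots> = (\<Sum>x\<in>out_neighbours u. ?q x + last_prob x v)"
    by (simp add: walk_prob_shift_minus uv)
  also have "\<dots> = (\<Sum>x\<in>out_neighbours u - {v}. ?q x + last_prob x v)"
    using uv qv by (simp add: sum.remove[of _ v] last_prob_self)
  also have "\<dots> = (\<Sum>x\<in>out_neighbours u - {v}. p)"
    using q0 p(2) uv(2) adj_in_verts(2) by (intro sum.cong) auto
  also have "\<dots> = (card (out_neighbours u) - 1) * p"
    using uv by simp
  finally have "card (out_neighbours u) = card (out_neighbours u) - 1"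
    using p(1) by simp
  moreover have "card (out_neighbours u) > 0"
    using uv by (auto simp: card_gt_0_iff)
  ultimately show False
    by simp
qed

section \<open>Reversing an arc by splicing walks\<close>

lemma arcs_bidirected:
  assumes uv: "u \<rightarrow>\<^bsub>G\<^esub> v"
  shows "v \<rightarrow>\<^bsub>G\<^esub> u"
proof (rule ccontr)
  assume nvu: "\<not> v \<rightarrow>\<^bsub>G\<^esub> u"
  have u: "u \<in> verts G" and v: "v \<in> verts G"
    using uv adj_in_verts by auto
  have "u \<noteq> v"
    using uv adj_not_same by auto
  obtain w where "v \<rightarrow>\<^bsub>G\<^esub> w"
    using out_neighbour_exists[OF v] by blast
  then have w: "w \<in> verts G" "w \<noteq> u" "w \<noteq> v"
    using nvu adj_in_verts adj_not_same by auto
  obtain p where p: "p > 0" "\<And>u v. \<lbrakk>u \<in> verts G; v \<in> verts G; u \<noteq> v\<rbrakk> \<Longrightarrow> last_prob u v = p"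
    using last_prob_constant by metis
  define H where "H = verts G - {u, v}"

  obtain x where x: "u \<rightarrow>\<^bsub>G\<^esub> x" "x \<noteq> v"
    "walk_prob x (case_nat u -` cover_tour_ends_at G v - cover_tour_ends_at G v) > 0"
    using shift_minus_pos_if_arc[OF u v \<open>u \<noteq> v\<close> uv w] .
  have "x \<in> verts G"
    using x(1) adj_in_verts by auto
  obtain \<omega> where "\<omega> \<in> case_nat u -` cover_tour_ends_at G v - cover_tour_ends_at G v"
    and \<omega>: "\<omega> 0 = x" "\<And>n. \<omega> n \<rightarrow>\<^bsub>G\<^esub> \<omega> (Suc n)"
    using walk_of_positive_prob[OF \<open>x \<in> verts G\<close> x(3)] by blast
  then obtain T where T: "\<omega> T = v" "\<forall>i<T. \<omega> i \<noteq> u \<and> \<omega> i \<noteq> v" "H \<subseteq> \<omega> ` {..<T}"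
    unfolding shift_minus_cover_tour_iff[OF u v \<open>u \<noteq> v\<close>] H_def by blast
  \<comment> \<open>Since \<open>x \<noteq> v\<close>, the visit to \<open>v\<close> is not at time
    0; up to \<open>t\<close> the walk stays in \<open>H\<close> and covers it.\<close>
  then obtain t where t: "T = Suc t"
    using \<omega>(1) x(2) by (cases T) auto
  have \<omega>_H: "\<omega> i \<in> H" if "i \<le> t" for i
    using that T(2) t \<omega>(2) adj_in_verts(1) by (auto simp: H_def)
  define xs where "xs = map \<omega> [0..<Suc t]"
  have xs: "xs \<noteq> []" "hd xs = x" "last xs = \<omega> t" "set xs = H" "successively (\<lambda>a b. a \<rightarrow>\<^bsub>G\<^esub> b) xs"
    using \<omega> T(3) t \<omega>_H
    by (auto simp: xs_def successively_conv_nth hd_map hd_upt last_map nth_append simp del: upt_Suc)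

  have "\<omega> t \<in> verts G" "\<omega> t \<noteq> v" "\<omega> t \<noteq> u"
    using \<omega>_H by (auto simp: H_def)
  then have "last_prob (\<omega> t) v > 0"
    using p v by simp
  then obtain \<omega>' where "\<omega>' \<in> cover_tour_ends_at G v"
    and \<omega>': "\<omega>' 0 = \<omega> t" "\<And>n. \<omega>' n \<rightarrow>\<^bsub>G\<^esub> \<omega>' (Suc n)"
    using walk_of_positive_prob[OF \<open>\<omega> t \<in> verts G\<close>] by metis
  then obtain T' where T': "\<omega>' T' = v" "\<forall>i<T'. \<omega>' i \<noteq> v" "verts G \<subseteq> \<omega>' ` {..T'}"
    by (auto simp: mem_cover_tour_ends_at_iff[OF v])
  \<comment> \<open>A tour ending at \<open>v\<close> meets \<open>u\<close> first. Up to
    \<open>r = s - 1\<close> it meets neither, so it stays in \<open>H\<close> and reaches an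
    in-neighbour of \<open>u\<close>.\<close>
  define s where "s = (LEAST i. \<omega>' i = u)"
  obtain k where k: "k \<le> T'" "\<omega>' k = u"
    using T'(3) u by auto
  then have s: "\<omega>' s = u" "s \<le> k"
    unfolding s_def by (auto intro: LeastI Least_le)
  have s_less: "\<omega>' i \<noteq> u" if "i < s" for i
    using that not_less_Least unfolding s_def by blast
  obtain r where r: "s = Suc r"
    using s(1) \<omega>'(1) \<open>\<omega> t \<noteq> u\<close> by (cases s) auto
  have \<omega>'_H: "\<omega>' i \<in> H" if "i \<le> r" for i
    using that s_less[of i] T'(2) s(2) k(1) r \<omega>'(2) adj_in_verts(1) by (auto simp: H_def)
  define zs where "zs = map \<omega>' [0..<Suc r]"
  have zs: "zs \<noteq> []" "hd zs = \<omega> t" "last zs = \<omega>' r" "set zs \<subseteq> H" "successively (\<lambda>a b. a \<rightarrow>\<^bsub>G\<^esub> b) zs"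
    using \<omega>' \<omega>'_H
    by (auto simp: zs_def successively_conv_nth hd_map hd_upt last_map nth_append simp del: upt_Suc)
  have "\<omega>' r \<rightarrow>\<^bsub>G\<^esub> u"
    using \<omega>'(2)[of r] s(1) r by simp

  define C where "C = {y. (y, x) \<in> rtrancl_on H (arcs_ends G)}"
  have "x \<in> C" "C \<subseteq> H"
    using \<omega>_H[of 0] \<omega>(1) by (auto simp: C_def dest: in_rtrancl_on_in_F)
  have "last_prob v u > 0"
    using p u v \<open>u \<noteq> v\<close> by simp
  then obtain \<phi> where "\<phi> \<in> cover_tour_ends_at G u"
    and \<phi>: "\<phi> 0 = v" "\<And>n. \<phi> n \<rightarrow>\<^bsub>G\<^esub> \<phi> (Suc n)"
    using walk_of_positive_prob[OF v] by metis
  then obtain S where S: "\<phi> S = u" "\<forall>i<S. \<phi> i \<noteq> u" "verts G \<subseteq> \<phi> ` {..S}"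
    by (auto simp: mem_cover_tour_ends_at_iff[OF u])
  \<comment> \<open>The tour from \<open>v\<close> ending at \<open>u\<close> visits
    \<open>x\<close>, hence enters \<open>C\<close>, and \<open>m\<close> is its first time
    there.\<close>
  define m where "m = (LEAST i. \<phi> i \<in> C)"
  obtain j where j: "j \<le> S" "\<phi> j = x"
    using S(3) \<open>x \<in> verts G\<close> by auto
  then have m: "\<phi> m \<in> C" "m \<le> S"
    using \<open>x \<in> C\<close> LeastI[of "\<lambda>i. \<phi> i \<in> C" j] Least_le[of "\<lambda>i. \<phi> i \<in> C" j] by (auto simp: m_def)
  then obtain l where l: "m = Suc l"
    using \<phi>(1) \<open>C \<subseteq> H\<close> by (cases m) (auto simp: H_def)
  have "\<phi> l \<notin> C"
    using not_less_Least[of l "\<lambda>i. \<phi> i \<in> C"] l by (simp add: m_def)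
  moreover have "\<phi> l \<rightarrow>\<^bsub>G\<^esub> \<phi> m"
    using \<phi>(2) l by simp
  \<comment> \<open>A predecessor of \<open>\<phi> m\<close> inside \<open>H\<close> would itself
    belong to \<open>C\<close>.\<close>
  ultimately have "\<phi> l \<notin> H"
    using m(1) by (auto simp: C_def intro: converse_rtrancl_on_into_rtrancl_on)
  \<comment> \<open>Before time \<open>S\<close> the tour avoids \<open>u\<close>, so only
    \<open>v\<close> remains; it may return to \<open>v\<close>, so \<open>l\<close> need not be
    0.\<close>
  then have "\<phi> l = v"
    using \<phi>(2) adj_in_verts(1) S(2) m(2) l by (auto simp: H_def)
  with \<open>\<phi> l \<rightarrow>\<^bsub>G\<^esub> \<phi> m\<close> have "v \<rightarrow>\<^bsub>G\<^esub> \<phi> m"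
    by simp
  have "(\<phi> m, x) \<in> rtrancl_on H (arcs_ends G)"
    using m(1) by (simp add: C_def)
  then obtain ys where ys: "ys \<noteq> []" "hd ys = \<phi> m" "last ys = x" "set ys \<subseteq> H" "successively (\<lambda>a b. a \<rightarrow>\<^bsub>G\<^esub> b) ys"
    by (rule rtrancl_on_imp_successively)

  note j1 = successively_join[OF ys(5) xs(5) ys(1) xs(1)]
  \<comment> \<open>From \<open>\<phi> m\<close> to \<open>x\<close>, then over all of
    \<open>H\<close> to \<open>\<omega> t\<close>, then on to an in-neighbour of \<open>u\<close>,
    always inside \<open>H\<close>.\<close>
  define ps where "ps = (ys @ tl xs) @ tl zs"
  have ps: "ps \<noteq> []" "hd ps = \<phi> m" "last ps = \<omega>' r" "set ps = H" "successively (\<lambda>a b. a \<rightarrow>\<^bsub>G\<^esub> b) ps"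
    using successively_join[OF j1(1) zs(5) _ zs(1)] j1 xs ys zs by (auto simp: ps_def)
  have "successively (\<lambda>a b. a \<rightarrow>\<^bsub>G\<^esub> b) (ps @ [u])"
    using ps \<open>\<omega>' r \<rightarrow>\<^bsub>G\<^esub> u\<close> by (simp add: successively_append_iff)
  \<comment> \<open>The roles of \<open>u\<close> and \<open>v\<close> are exchanged here: the
    missing arc is the one from \<open>v\<close> to \<open>u\<close>.\<close>
  moreover have "walk_prob (\<phi> m) (case_nat v -` cover_tour_ends_at G u - cover_tour_ends_at G u) = 0"
    using shift_minus_null_if_no_arc[OF v u _ nvu \<open>v \<rightarrow>\<^bsub>G\<^esub> \<phi> m\<close>] \<open>u \<noteq> v\<close> by simp
  moreover have "case_nat v -` cover_tour_ends_at G u - cover_tour_ends_at G u \<in> sets (random_walk G (\<phi> m))"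
    by (intro sets.Diff sets_shift sets_cover_tour_ends_at_PiM sets_cover_tour_ends_at finite_verts)
  \<comment> \<open>\<open>\<psi>\<close> lies outside the null event, yet it begins with
    \<open>ps @ [u]\<close>, and this prefix alone forces it inside.\<close>
  ultimately obtain \<psi> where \<psi>: "\<psi> \<notin> case_nat v -` cover_tour_ends_at G u - cover_tour_ends_at G u"
    "\<And>i. i < length (ps @ [u]) \<Longrightarrow> \<psi> i = (ps @ [u]) ! i"
    using path_avoiding_null_event[of _ "\<phi> m" "ps @ [u]"] ps(1,2) by (metis append_is_Nil_conv hd_append2)
  have \<psi>_ps: "\<psi> i = ps ! i" if "i < length ps" for i
    using \<psi>(2)[of i] that by (simp add: nth_append)
  have "\<psi> (length ps) = u"
    using \<psi>(2)[of "length ps"] by simp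
  moreover have "\<forall>i<length ps. \<psi> i \<noteq> v \<and> \<psi> i \<noteq> u"
    using ps(4) nth_mem[of _ ps] by (auto simp: \<psi>_ps H_def)
  moreover have "verts G - {v, u} \<subseteq> \<psi> ` {..<length ps}"
  proof
    fix y assume "y \<in> verts G - {v, u}"
    then have "y \<in> set ps"
      using ps(4) by (auto simp: H_def)
    then obtain i where "i < length ps" "ps ! i = y"
      by (auto simp: in_set_conv_nth)
    then show "y \<in> \<psi> ` {..<length ps}"
      using \<psi>_ps by auto
  qed
  ultimately show False
    using \<psi>(1) unfolding shift_minus_cover_tour_iff[OF v u \<open>u \<noteq> v\<close>[symmetric]] by blast
qed

end

theorem theorem2:
  fixes G :: "('a, 'b) pre_digraph"
  assumes "digraph G" and "strongly_connected G"
    and "\<And>u v w. \<lbrakk>u \<in> verts G; v \<in> verts G; w \<in> verts G; u \<noteq> v; u \<noteq> w; v \<noteq> w\<rbrakk> \<Longrightarrow>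
      measure (random_walk G u) (cover_tour_ends_at G v) =
      measure (random_walk G u) (cover_tour_ends_at G w)"
  shows "\<forall>u\<in>verts G. \<forall>v\<in>verts G. u \<rightarrow>\<^bsub>G\<^esub> v \<longrightarrow> v \<rightarrow>\<^bsub>G\<^esub> u"
proof (intro ballI impI)
  fix u v
  assume uv: "u \<in> verts G" "v \<in> verts G" "u \<rightarrow>\<^bsub>G\<^esub> v"
  interpret digraph G
    by fact
  \<comment> \<open>An arc that is not a loop supplies the two distinct vertices that the locale
    asks for.\<close>
  have "u \<noteq> v"
    using uv(3) adj_not_same by auto
  interpret uniform_cover_digraph G
  proof
    show "\<exists>u\<in>verts G. \<exists>v\<in>verts G. u \<noteq> v"
      using uv \<open>u \<noteq> v\<close> by blast
  qed (fact assms)+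
  show "v \<rightarrow>\<^bsub>G\<^esub> u"
    using uv(3) by (rule arcs_bidirected)
qed

end
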